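(* For every integer $n\ge 3$, $$\rho(F_2(C_n))\ \ge\ \left\lfloor\frac{n(n-2)}{10}\right\rfloor+1 .$$
   Context: $C_n$ is the cycle graph on $n$ vertices. For a simple graph $G$, the $2$-token graph $F_2(G)$ is the graph whose vertices are all the $2$-element subsets of $V(G)$, where two vertices $A,B$ are adjacent if and only if their symmetric difference $A\triangle B$ is (the vertex set of) an edge of $G$. A set $P\subseteq V(H)$ of vertices of a graph $H$ is a packing set if $d_H(x,y)\ge 3$ for all distinct $x,y\in P$, where $d_H$ is the graph distance. The packing number $\rho(H)$ is the maximum size of a packing set of $H$. *)

theory Defs
  imports Complex_Main "Graph_Theory.Graph_Theory"
begin

text \<open>
  Finite simple graphs are taken from the AFP entry Graph_Theory, as the locale
  \<^locale>\<open>pair_graph\<close>: finite, loop-free digraphs on pairs with a symmetric arc set, an edge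
  $uv$ being represented by the two arcs $(u,v)$ and $(v,u)$.
\<close>

text \<open>Intended for $n \geq 3$ only; for $n = 1$ this has a loop.\<close>

definition cycle_graph :: "nat \<Rightarrow> nat pair_pre_digraph" where
  "cycle_graph n = \<lparr> pverts = {..<n},
     parcs = {(i, j). i < n \<and> j < n \<and> (j = Suc i mod n \<or> i = Suc j mod n)} \<rparr>"

definition two_token_graph :: "'a pair_pre_digraph \<Rightarrow> 'a set pair_pre_digraph" where
  "two_token_graph G = \<lparr> pverts = {A. A \<subseteq> pverts G \<and> card A = 2},
     parcs = {(A, B). A \<subseteq> pverts G \<and> card A = 2 \<and> B \<subseteq> pverts G \<and> card B = 2 \<and>
                (\<exists>u v. (u, v) \<in> parcs G \<and> sym_diff A B = {u, v})} \<rparr>"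

text \<open>
  The library's shortest-path cost \<open>\<mu>\<close> with all arcs of cost 1: the infimum of the
  lengths of the walks from \<open>x\<close> to \<open>y\<close>, which is \<open>\<infinity>\<close> if there is none.
\<close>

definition graph_dist :: "'a pair_pre_digraph \<Rightarrow> 'a \<Rightarrow> 'a \<Rightarrow> ereal" where
  "graph_dist H x y = wf_digraph.\<mu> (with_proj H) (\<lambda>_. 1) x y"

definition packing_set :: "'a pair_pre_digraph \<Rightarrow> 'a set \<Rightarrow> bool" where
  "packing_set H P \<longleftrightarrow> P \<subseteq> pverts H \<and> (\<forall>x\<in>P. \<forall>y\<in>P. x \<noteq> y \<longrightarrow> 3 \<le> graph_dist H x y)"

text \<open>Meaningful for finite \<open>H\<close>, where the maximum is over a finite nonempty set.\<close>

definition packing_number :: "'a pair_pre_digraph \<Rightarrow> nat" where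
  "packing_number H = Max {card P |P. packing_set H P}"

lemma pair_graph_cycle_graph:
  assumes "3 \<le> n"
  shows "pair_graph (cycle_graph n)"
proof
  show "finite (parcs (cycle_graph n))"
    by (rule finite_subset[of _ "{..<n} \<times> {..<n}"]) (auto simp: cycle_graph_def)
  show "symmetric (with_proj (cycle_graph n))"
    by (auto simp: symmetric_def cycle_graph_def intro!: symI)
  show "fst e \<noteq> snd e" if "e \<in> parcs (cycle_graph n)" for e
  proof -
    have "Suc i mod n \<noteq> i" if "i < n" for i
      using assms that by (cases "Suc i = n") auto
    then show ?thesis
      using that by (fastforce simp: cycle_graph_def)
  qed
qed (auto simp: cycle_graph_def)

lemma pair_graph_two_token_graph:
  assumes "pair_graph G"
  shows "pair_graph (two_token_graph G)"
proof -
  interpret pair_graph G by fact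
  have fin: "finite {A. A \<subseteq> pverts G \<and> card A = 2}"
    by (rule finite_subset[of _ "Pow (pverts G)"]) (auto simp: pair_finite_verts)
  show ?thesis
  proof
    show "finite (pverts (two_token_graph G))"
      using fin by (simp add: two_token_graph_def)
    show "finite (parcs (two_token_graph G))"
      by (rule finite_subset[OF _ finite_cartesian_product[OF fin fin]])
        (auto simp: two_token_graph_def)
    show "symmetric (with_proj (two_token_graph G))"
      unfolding symmetric_def
      by (rule symI) (simp add: two_token_graph_def Un_commute)
  qed (auto simp: two_token_graph_def)
qed

lemma graph_dist_eq:
  assumes "pair_graph H"
  shows "graph_dist H x y =
    (INF p\<in>{p. pre_digraph.awalk (with_proj H) x p y}. ereal (real (length p)))"
proof -
  interpret pair_graph H by fact
  have "awalk_cost (\<lambda>_. 1) p = real (length p)" for p :: "('a \<times> 'a) list"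
    by (induction p) auto
  then show ?thesis
    by (simp add: graph_dist_def \<mu>_def)
qed

lemma packing_number_eq_iff:
  assumes "finite (pverts H)"
  shows "packing_number H = k \<longleftrightarrow>
    (\<exists>P. packing_set H P \<and> card P = k) \<and> (\<forall>P. packing_set H P \<longrightarrow> card P \<le> k)"
proof -
  have "finite {card P |P. packing_set H P}"
    by (rule finite_subset[of _ "card ` Pow (pverts H)"])
      (auto simp: packing_set_def assms)
  moreover have "packing_set H {}"
    by (simp add: packing_set_def)
  ultimately show ?thesis
    unfolding packing_number_def by (subst Max_eq_iff) auto
qed

end

theory Submission
  imports Defs
begin

text \<open>
  Lift a pair of vertices to integers $i < j < i + n$ and put $t = i + j$, $d = j - i$. The token
  graph becomes the strip $0 < d < n$ in which a move changes $t$ and $d$ by one each, modulo the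
  glide reflection $(t, d) \mapsto (t + n, n - d)$. The perfect code $t \equiv 3 d + e$ (mod 10),
  $e$ even, of the plane is chiral and does not survive the glide; leaving one of the $n$ diagonals
  $t = const$ empty creates the room for the seam between the code and its mirror image, for
  suitable residues of $e$ modulo 5. The points of the code in a square of side $n - 1$ number at
  least $(n - 1)^2 / 10$ for a suitable $e$, which is more than $n (n - 2) / 10$, except for
  $n \equiv 0, 2$ (mod 10), when exactly $n (n - 2) / 10$ points are obtained. In these cases one
  point is gained at the boundary: the rows $d = 1, 2, 3$, with one code point in ten each, are
  repacked with two points in ten in row 1, one in row 2 and none in row 3.
\<close>

section \<open>Distance three, and moves of tokens lifted to pairs of integers\<close>

lemma three_le_graph_dist:
  assumes "pair_graph H" and "x \<noteq> y" and "(x, y) \<notin> parcs H"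
    and "\<And>z. (x, z) \<in> parcs H \<Longrightarrow> (z, y) \<notin> parcs H"
  shows "3 \<le> graph_dist H x y"
proof -
  interpret pair_graph H by fact
  have "3 \<le> length p" if "awalk x p y" for p
  proof (rule ccontr)
    assume "\<not> 3 \<le> length p"
    then consider "p = []" | a where "p = [a]" | a b where "p = [a, b]"
      by (auto simp: not_le less_Suc_eq numeral_3_eq_3 length_Suc_conv)
    then show False
    proof cases
      case 1
      then show False using that assms(2) by (simp add: awalk_Nil_iff)
    next
      case 2
      then show False using that assms(3) by (cases a) (simp add: awalk_Cons_iff awalk_Nil_iff)
    next
      case 3
      then show False using that assms(4) by (cases a; cases b) (auto simp: awalk_Cons_iff awalk_Nil_iff)
    qed
  qed
  then show ?thesis
    unfolding graph_dist_eq[OF assms(1)] by (auto intro!: INF_greatest)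
qed

text \<open>Arbitrary integers are allowed so that both tokens can be followed around the cycle
  without reduction modulo \<open>n\<close>. The set collapses to a singleton when \<open>n\<close>
  divides \<open>i - j\<close>.\<close>

definition token_pair :: "nat \<Rightarrow> int \<Rightarrow> int \<Rightarrow> nat set" where
  "token_pair n i j = {nat (i mod int n), nat (j mod int n)}"

lemma nat_mod_eq_iff:
  assumes "0 < n"
  shows "nat (i mod int n) = nat (j mod int n) \<longleftrightarrow> int n dvd i - j"
  using assms by (simp add: nat_eq_iff mod_eq_dvd_iff)

lemma cycle_graph_arc_lift:
  assumes "(nat (i mod int n), v) \<in> parcs (cycle_graph n)"
  shows "v = nat ((i + 1) mod int n) \<or> v = nat ((i - 1) mod int n)"
proof -
  let ?u = "nat (i mod int n)"
  have v: "v < n" and or: "v = Suc ?u mod n \<or> ?u = Suc v mod n"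
    using assms by (auto simp: cycle_graph_def)
  have u: "int ?u = i mod int n"
    using v by simp
  from or show ?thesis
  proof
    assume "v = Suc ?u mod n"
    then have "int v = (int ?u + 1) mod int n"
      by (simp add: zmod_int ac_simps)
    then show ?thesis
      unfolding u by (simp add: mod_add_left_eq nat_eq_iff2)
  next
    assume "?u = Suc v mod n"
    then have "i mod int n = (int v + 1) mod int n"
      using u by (metis int_Suc zmod_int of_nat_Suc add.commute)
    then have "(i - 1) mod int n = (int v + 1 - 1) mod int n"
      by (metis mod_diff_left_eq)
    then show ?thesis
      using v by simp
  qed
qed

text \<open>Two 2-sets whose symmetric difference has two elements share exactly one element
  \<open>w\<close>. Either of \<open>u\<close>, \<open>v\<close> may lie in \<open>A\<close>;
  symmetry of the arcs makes the two cases alike.\<close>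

lemma two_token_arcE:
  assumes "(A, B) \<in> parcs (two_token_graph G)" and "pair_graph G"
  obtains w u v where "A = {w, u}" "B = {w, v}" "(u, v) \<in> parcs G"
proof -
  interpret pair_graph G by fact
  obtain u v where uv: "(u, v) \<in> parcs G" "sym_diff A B = {u, v}" and card: "card A = 2" "card B = 2"
    using assms(1) by (auto simp: two_token_graph_def)
  have vu: "(v, u) \<in> parcs G"
    using uv(1) sym_arcs by (auto simp: symmetric_def dest: symD)
  have "u \<noteq> v"
    using uv(1) pair_no_loops by fastforce
  obtain a b c d where "A = {a, b}" "a \<noteq> b" "B = {c, d}" "c \<noteq> d"
    using card by (auto simp: card_2_iff)
  then have "\<exists>w. A = {w, u} \<and> B = {w, v} \<or> A = {w, v} \<and> B = {w, u}"
    using uv(2) \<open>u \<noteq> v\<close> by (smt (verit, ccfv_threshold) Diff_iff Un_iff doubleton_eq_iff insert_iff singletonD)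
  then show thesis
    using that uv(1) vu by blast
qed

text \<open>A move changes the gap \<open>j - i\<close> by one, so it could leave the open interval
  from 0 to \<open>n\<close> only by reaching an end. There the tokens would coincide, against
  \<open>card B = 2\<close>.\<close>

lemma token_pair_arc_lift:
  assumes "3 \<le> n" "0 < j - i" "j - i < int n"
    and "(token_pair n i j, B) \<in> parcs (two_token_graph (cycle_graph n))"
  obtains i' j' where "B = token_pair n i' j'" "0 < j' - i'" "j' - i' < int n"
    "\<bar>i' - i\<bar> + \<bar>j' - j\<bar> = 1"
proof -
  obtain w u v where wuv: "token_pair n i j = {w, u}" "B = {w, v}" "(u, v) \<in> parcs (cycle_graph n)"
    using two_token_arcE[OF assms(4) pair_graph_cycle_graph[OF assms(1)]] .
  have "card B = 2"
    using assms(4) by (auto simp: two_token_graph_def)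
  consider "u = nat (i mod int n)" "w = nat (j mod int n)" | "u = nat (j mod int n)" "w = nat (i mod int n)"
    using wuv(1) by (auto simp: token_pair_def doubleton_eq_iff)
  then have "\<exists>i' j'. B = token_pair n i' j' \<and> \<bar>i' - i\<bar> + \<bar>j' - j\<bar> = 1"
  proof cases
    case 1
    then have "v = nat ((i + 1) mod int n) \<or> v = nat ((i - 1) mod int n)"
      using wuv(3) cycle_graph_arc_lift by blast
    then have "B = token_pair n (i + 1) j \<or> B = token_pair n (i - 1) j"
      using wuv(2) 1 by (auto simp: token_pair_def)
    moreover have "\<bar>i + 1 - i\<bar> + \<bar>j - j\<bar> = 1" "\<bar>i - 1 - i\<bar> + \<bar>j - j\<bar> = 1"
      by auto
    ultimately show ?thesis by blast
  next
    case 2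
    then have "v = nat ((j + 1) mod int n) \<or> v = nat ((j - 1) mod int n)"
      using wuv(3) cycle_graph_arc_lift by blast
    then have "B = token_pair n i (j + 1) \<or> B = token_pair n i (j - 1)"
      using wuv(2) 2 by (auto simp: token_pair_def)
    moreover have "\<bar>i - i\<bar> + \<bar>j + 1 - j\<bar> = 1" "\<bar>i - i\<bar> + \<bar>j - 1 - j\<bar> = 1"
      by auto
    ultimately show ?thesis by blast
  qed
  then obtain i' j' where ij: "B = token_pair n i' j'" "\<bar>i' - i\<bar> + \<bar>j' - j\<bar> = 1"
    by blast
  have "\<not> int n dvd i' - j'"
  proof
    assume "int n dvd i' - j'"
    then have "nat (i' mod int n) = nat (j' mod int n)"
      using nat_mod_eq_iff[of n i' j'] assms(1) by simp
    then show False
      using \<open>card B = 2\<close> ij(1) by (simp add: token_pair_def)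
  qed
  then have "j' - i' \<noteq> 0" "j' - i' \<noteq> int n"
    by (auto simp: dvd_diff_commute[of _ i'])
  then show thesis
    using that ij assms(2,3) by auto
qed

text \<open>The bounds on the gaps tie the multiples of \<open>n\<close> in the two coordinates to
  each other. The first case is a rotation by full turns. In the second the tokens are exchanged:
  the sum \<open>i + j\<close> shifts by an odd multiple of \<open>n\<close> and a gap g becomes n -
  g, which is the glide reflection.\<close>

lemma token_pair_eqE:
  assumes "0 < n" "0 < j - i" "j - i < int n" "0 < l - k" "l - k < int n"
    and "token_pair n i j = token_pair n k l"
  obtains m where "i = k + m * int n" "j = l + m * int n"
  | m where "i = l + m * int n" "j = k + (m + 1) * int n"
proof -
  have eq: "\<exists>m. x = y + m * int n" if "nat (x mod int n) = nat (y mod int n)" for x y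
  proof -
    have "int n dvd x - y"
      using that nat_mod_eq_iff[OF assms(1)] by blast
    then obtain m where "x - y = int n * m" ..
    then show ?thesis by (auto intro!: exI[of _ m] simp: algebra_simps)
  qed
  consider "nat (i mod int n) = nat (k mod int n)" "nat (j mod int n) = nat (l mod int n)"
    | "nat (i mod int n) = nat (l mod int n)" "nat (j mod int n) = nat (k mod int n)"
    using assms(6) by (auto simp: token_pair_def doubleton_eq_iff)
  then show thesis
  proof cases
    case 1
    then obtain a b where ab: "i = k + a * int n" "j = l + b * int n"
      using eq by blast
    then have "(b - a) * int n < 1 * int n" "(-1) * int n < (b - a) * int n"
      using assms(2-5) by (auto simp: algebra_simps)
    then have "b - a < 1" "-1 < b - a"
      using assms(1) by (metis mult_less_cancel_right_pos of_nat_0_less_iff)+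
    then show thesis
      using that(1)[of a] ab by simp
  next
    case 2
    then obtain a b where ab: "i = l + a * int n" "j = k + b * int n"
      using eq by blast
    then have "b * int n - a * int n < 2 * int n" "a * int n < b * int n"
      using assms(2-5) by linarith+
    then have "(b - a) * int n < 2 * int n" "a * int n < b * int n"
      by (simp_all only: left_diff_distrib)
    then have "b - a < 2" "a < b"
      using assms(1) by (metis mult_less_cancel_right_pos of_nat_0_less_iff)+
    then have "b = a + 1" by simp
    then show thesis
      using that(2)[of a] ab by simp
  qed
qed

section \<open>The strip of sums and differences\<close>

text \<open>Meaningful only if $t + d$ is even.\<close>

definition strip_vertex :: "nat \<Rightarrow> int \<times> int \<Rightarrow> nat set" where
  "strip_vertex n = (\<lambda>(t, d). token_pair n ((t - d) div 2) ((t + d) div 2))"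

lemma strip_vertex_close:
  assumes "3 \<le> n"
    and "even (t + d)" "0 < d" "d < int n" and "even (t' + d')" "0 < d'" "d' < int n"
    and st: "s \<le> t" "t < s + int n" "s \<le> t'" "t' < s + int n"
    and "\<bar>i - (t - d) div 2\<bar> + \<bar>j - (t + d) div 2\<bar> \<le> 2" "0 < j - i" "j - i < int n"
    and "token_pair n i j = strip_vertex n (t', d')"
  shows "\<bar>t - t'\<bar> \<le> 2 \<and> \<bar>d - d'\<bar> \<le> 2
    \<or> \<bar>t - t' - int n\<bar> \<le> 2 \<and> \<bar>d + d' - int n\<bar> \<le> 2
    \<or> \<bar>t' - t - int n\<bar> \<le> 2 \<and> \<bar>d + d' - int n\<bar> \<le> 2"
proof -
  define k l where "k = (t' - d') div 2" and "l = (t' + d') div 2"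
  have kl: "k + l = t'" "l - k = d'"
    using assms(5) unfolding k_def l_def by presburger+
  define a b where "a = (t - d) div 2" and "b = (t + d) div 2"
  have ab: "a + b = t" "b - a = d"
    using assms(2) unfolding a_def b_def by presburger+
  have ijab: "\<bar>i - a\<bar> + \<bar>j - b\<bar> \<le> 2"
    using assms(12) by (simp add: a_def b_def)
  have eq: "token_pair n i j = token_pair n k l"
    using assms(15) by (simp add: strip_vertex_def k_def l_def)
  have near: "\<bar>(i + j) - t\<bar> \<le> 2" "\<bar>(j - i) - d\<bar> \<le> 2"
    using ijab ab by linarith+
  have "0 < n" and lk: "0 < l - k" "l - k < int n"
    using assms(1,6,7) kl by auto
  from \<open>0 < n\<close> assms(13,14) lk eq show ?thesis
  proof (cases rule: token_pair_eqE)
    case (1 m)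
    then have ij: "i + j = t' + (2 * m) * int n" "j - i = d'"
      using kl by (auto simp: algebra_simps)
    \<comment> \<open>The values \<open>t\<close> and \<open>t'\<close> differ by at most n - 1 and
      the moves add at most 2. As n >= 3, n + 1 < 2 n, so only the shift 0 is left here, and only
      the shifts by n and -n in the exchanged case.\<close>
    then have "(2 * m) * int n < 2 * int n" "(-2) * int n < (2 * m) * int n"
      using st near(1) assms(1) by linarith+
    then have "2 * m < 2" "-2 < 2 * m"
      using \<open>0 < n\<close> by (metis mult_less_cancel_right_pos of_nat_0_less_iff)+
    then have "m = 0" by simp
    then show ?thesis
      using ij near by auto
  next
    case (2 m)
    then have ij: "i + j = t' + (2 * m + 1) * int n" "j - i = int n - d'"
      using kl by (auto simp: algebra_simps)
    then have "(2 * m + 1) * int n < 2 * int n" "(-2) * int n < (2 * m + 1) * int n"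
      using st near(1) assms(1) by linarith+
    then have "2 * m + 1 < 2" "-2 < 2 * m + 1"
      using \<open>0 < n\<close> by (metis mult_less_cancel_right_pos of_nat_0_less_iff)+
    then have "m = 0 \<or> m = -1" by auto
    then show ?thesis
      using ij near by auto
  qed
qed

text \<open>Since |a| + |b| is the larger of |a + b| and |b - a|, balls of the grid metric in the
  two integers are squares in the coordinates (t, d). Thus \<open>local\<close> and
  \<open>seam\<close> keep two points, and a point and the glide image of another, more than 2
  apart; exchanging the points covers the glide in the other direction.\<close>

lemma packing_number_ge_card_strip:
  assumes "3 \<le> n" and "finite S"
    and range: "\<And>t d. (t, d) \<in> S \<Longrightarrow> even (t + d) \<and> 0 < d \<and> d < int n \<and> s \<le> t \<and> t < s + int n"
    and local: "\<And>t d t' d'. (t, d) \<in> S \<Longrightarrow> (t', d') \<in> S \<Longrightarrow> \<bar>t - t'\<bar> \<le> 2 \<Longrightarrow> \<bar>d - d'\<bar> \<le> 2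
      \<Longrightarrow> t = t' \<and> d = d'"
    and seam: "\<And>t d t' d'. (t, d) \<in> S \<Longrightarrow> (t', d') \<in> S \<Longrightarrow> \<bar>t - t' - int n\<bar> \<le> 2
      \<Longrightarrow> 2 < \<bar>d + d' - int n\<bar>"
  shows "card S \<le> packing_number (two_token_graph (cycle_graph n))"
proof -
  let ?H = "two_token_graph (cycle_graph n)"
  have H: "pair_graph ?H"
    by (intro pair_graph_two_token_graph pair_graph_cycle_graph assms(1))
  \<comment> \<open>This covers zero, one and two moves alike: the unmoved lift gives injectivity,
    one and two moves give distance at least 3.\<close>
  have far: "(t, d) = (t', d')"
    if S: "(t, d) \<in> S" "(t', d') \<in> S"
      and ij: "\<bar>i - (t - d) div 2\<bar> + \<bar>j - (t + d) div 2\<bar> \<le> 2" "0 < j - i" "j - i < int n"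
      and eq: "token_pair n i j = strip_vertex n (t', d')" for t d t' d' i j
    using strip_vertex_close[OF assms(1) _ _ _ _ _ _ _ _ _ _ ij eq, of s]
      range[OF S(1)] range[OF S(2)] local[OF S] seam[OF S] seam[OF S(2,1)]
    by (auto simp: add.commute)
  have gap: "0 < (t + d) div 2 - (t - d) div 2" "(t + d) div 2 - (t - d) div 2 < int n"
    if "(t, d) \<in> S" for t d
    using range[OF that] by presburger+
  have inj: "inj_on (strip_vertex n) S"
  proof (rule inj_onI)
    fix p q assume "p \<in> S" "q \<in> S" "strip_vertex n p = strip_vertex n q"
    moreover obtain t d t' d' where "p = (t, d)" "q = (t', d')"
      by (cases p; cases q)
    ultimately show "p = q"
      using far[of t d t' d' "(t - d) div 2" "(t + d) div 2"] gap[of t d]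
      by (simp add: strip_vertex_def)
  qed
  have vert: "strip_vertex n p \<in> pverts ?H" if "p \<in> S" for p
  proof -
    obtain t d where p: "p = (t, d)" by (cases p)
    let ?i = "(t - d) div 2" and ?j = "(t + d) div 2"
    have "\<not> int n dvd ?j - ?i"
      using gap[of t d] that p zdvd_not_zless by blast
    then have "nat (?j mod int n) \<noteq> nat (?i mod int n)"
      using nat_mod_eq_iff[of n] assms(1) by simp
    then show ?thesis
      using assms(1) by (auto simp: p strip_vertex_def token_pair_def two_token_graph_def
          cycle_graph_def nat_less_iff card_2_iff)
  qed
  have "3 \<le> graph_dist ?H (strip_vertex n p) (strip_vertex n q)"
    if pq: "p \<in> S" "q \<in> S" "p \<noteq> q" for p q
  proof (rule three_le_graph_dist[OF H])
    obtain t d t' d' where p: "p = (t, d)" and q: "q = (t', d')"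
      by (cases p; cases q)
    let ?i = "(t - d) div 2" and ?j = "(t + d) div 2"
    have S: "(t, d) \<in> S" "(t', d') \<in> S" using pq p q by auto
    have pv: "strip_vertex n p = token_pair n ?i ?j"
      by (simp add: p strip_vertex_def)
    show "strip_vertex n p \<noteq> strip_vertex n q"
      using inj pq by (auto dest: inj_onD)
    have step: "\<exists>i j. B = token_pair n i j \<and> 0 < j - i \<and> j - i < int n \<and> \<bar>i - ?i\<bar> + \<bar>j - ?j\<bar> = 1"
      if "(strip_vertex n p, B) \<in> parcs ?H" for B
      using token_pair_arc_lift[OF assms(1) gap[OF S(1)] that[unfolded pv]] by blast
    show "(strip_vertex n p, strip_vertex n q) \<notin> parcs ?H"
    proof
      assume "(strip_vertex n p, strip_vertex n q) \<in> parcs ?H"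
      then obtain i j where "strip_vertex n q = token_pair n i j" "0 < j - i" "j - i < int n"
        "\<bar>i - ?i\<bar> + \<bar>j - ?j\<bar> = 1"
        using step by blast
      then show False
        using far[OF S, of i j] pq(3) by (simp add: p q)
    qed
    show "(z, strip_vertex n q) \<notin> parcs ?H" if z: "(strip_vertex n p, z) \<in> parcs ?H" for z
    proof
      assume zq: "(z, strip_vertex n q) \<in> parcs ?H"
      obtain i j where ij: "z = token_pair n i j" "0 < j - i" "j - i < int n"
        "\<bar>i - ?i\<bar> + \<bar>j - ?j\<bar> = 1"
        using step[OF z] by blast
      obtain i' j' where ij': "strip_vertex n q = token_pair n i' j'" "0 < j' - i'" "j' - i' < int n"
        "\<bar>i' - i\<bar> + \<bar>j' - j\<bar> = 1"
        using token_pair_arc_lift[OF assms(1) ij(2,3) zq[unfolded ij(1)]] .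
      have "\<bar>i' - ?i\<bar> + \<bar>j' - ?j\<bar> \<le> 2"
        using ij(4) ij'(4) by linarith
      then have "(t, d) = (t', d')"
        using far[OF S _ ij'(2,3)] ij'(1) q by metis
      then show False
        using pq(3) p q by simp
    qed
  qed
  then have "packing_set ?H (strip_vertex n ` S)"
    using vert by (auto simp: packing_set_def)
  moreover have "finite (pverts ?H)"
  proof -
    interpret pair_graph ?H by (fact H)
    show ?thesis by (rule pair_finite_verts)
  qed
  ultimately have "card (strip_vertex n ` S) \<le> packing_number ?H"
    using packing_number_eq_iff by blast
  then show ?thesis
    by (simp add: card_image inj)
qed

section \<open>Counting points of the code row by row\<close>

definition residue_row :: "int \<Rightarrow> int \<Rightarrow> int \<Rightarrow> int set" where
  "residue_row s N x = {t. s \<le> t \<and> t < s + N \<and> t mod 10 = x mod 10}"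

lemma finite_residue_row [simp]: "finite (residue_row s N x)"
  by (rule finite_subset[of _ "{s..<s + N}"]) (auto simp: residue_row_def)

lemma residue_rowE:
  assumes "t \<in> residue_row s N x"
  obtains k where "s \<le> t" "t < s + N" "t = 10 * k + x"
proof -
  have "10 dvd t - x"
    using assms by (simp add: residue_row_def mod_eq_dvd_iff)
  then obtain k where "t - x = 10 * k" ..
  then show thesis
    using assms that[of k] by (simp add: residue_row_def)
qed

lemma mod_10_eq_iff_window:
  fixes a t x :: int
  assumes "a \<le> t" "t < a + 10"
  shows "t mod 10 = x mod 10 \<longleftrightarrow> t = a + (x - a) mod 10"
proof
  assume "t mod 10 = x mod 10"
  then have "(x - a) mod 10 = (t - a) mod 10"
    by (metis mod_diff_cong)
  also have "\<dots> = t - a"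
    using assms by simp
  finally show "t = a + (x - a) mod 10"
    by simp
next
  assume "t = a + (x - a) mod 10"
  then have "t mod 10 = (a + (x - a)) mod 10"
    by (simp only: mod_add_right_eq)
  then show "t mod 10 = x mod 10"
    by simp
qed

text \<open>Ten consecutive integers meet a residue class once. The partial block of length
  \<open>r\<close> comes first, and the induction appends blocks of ten at the upper end.\<close>

lemma card_residue_row:
  assumes "r < 10"
  shows "card (residue_row s (int (10 * q + r)) x) = q + (if (x - s) mod 10 < int r then 1 else 0)"
proof (induction q)
  case 0
  have "residue_row s (int r) x = (if (x - s) mod 10 < int r then {s + (x - s) mod 10} else {})"
  proof (rule set_eqI)
    fix t
    have "t \<in> residue_row s (int r) x \<longleftrightarrow> s \<le> t \<and> t < s + int r \<and> t = s + (x - s) mod 10"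
      using mod_10_eq_iff_window[of s t x] assms by (auto simp: residue_row_def)
    then show "t \<in> residue_row s (int r) x
      \<longleftrightarrow> t \<in> (if (x - s) mod 10 < int r then {s + (x - s) mod 10} else {})"
      by auto
  qed
  then show ?case by simp
next
  case (Suc q)
  let ?N = "int (10 * q + r)"
  let ?t = "s + ?N + (x - (s + ?N)) mod 10"
  have "residue_row s (int (10 * Suc q + r)) x = insert ?t (residue_row s ?N x)"
  proof (rule set_eqI)
    fix t
    show "t \<in> residue_row s (int (10 * Suc q + r)) x \<longleftrightarrow> t \<in> insert ?t (residue_row s ?N x)"
    proof (cases "s + ?N \<le> t \<and> t < s + ?N + 10")
      case True
      then show ?thesis
        using mod_10_eq_iff_window[of "s + ?N" t x] by (auto simp: residue_row_def)
    next
      case False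
      then have "t \<noteq> ?t"
        by (smt (verit) pos_mod_bound pos_mod_sign)
      with False show ?thesis
        by (auto simp: residue_row_def)
    qed
  qed
  moreover have "?t \<notin> residue_row s ?N x"
    by (auto simp: residue_row_def)
  ultimately show ?case
    using Suc.IH by simp
qed

text \<open>As 3 is invertible modulo 10, ten consecutive rows run through every residue
  once.\<close>

lemma sum_residues_3:
  fixes f :: "int \<Rightarrow> nat"
  shows "(\<Sum>d = 1..10. f ((3 * int d + x) mod 10)) = (\<Sum>k = 0..9. f k)"
proof -
  define y where "y = x mod 10"
  have "{1..10::nat} = {1, 2, 3, 4, 5, 6, 7, 8, 9, 10}"
    by (auto; arith)
  moreover have "{0..9::int} = {0, 1, 2, 3, 4, 5, 6, 7, 8, 9}"
    by (auto; arith)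
  moreover have "y = 0 \<or> y = 1 \<or> y = 2 \<or> y = 3 \<or> y = 4 \<or> y = 5 \<or> y = 6 \<or> y = 7 \<or> y = 8 \<or> y = 9"
    unfolding y_def by presburger
  ultimately have "(\<Sum>d = 1..10. f ((3 * int d + y) mod 10)) = (\<Sum>k = 0..9. f k)"
    by (elim disjE) (simp_all add: ac_simps)
  then show ?thesis
    by (simp only: y_def mod_add_right_eq)
qed

lemma sum_periodic:
  fixes h :: "nat \<Rightarrow> nat"
  assumes "\<And>d. h (d + 10) = h d"
  shows "(\<Sum>d = 1..10 * q + r. h d) = q * (\<Sum>d = 1..10. h d) + (\<Sum>d = 1..r. h d)"
proof (induction q)
  case (Suc q)
  have "(\<Sum>d = 1..10 * Suc q + r. h d) = (\<Sum>d = 1..10. h d) + (\<Sum>d = 11..10 * Suc q + r. h d)"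
    using sum.ub_add_nat[of 1 10 h "10 * q + r"] by (simp add: ac_simps)
  also have "(\<Sum>d = 11..10 * Suc q + r. h d) = (\<Sum>d = 1..10 * q + r. h d)"
    using sum.shift_bounds_cl_nat_ivl[of h 1 10 "10 * q + r"] assms by (simp add: ac_simps)
  finally show ?case
    using Suc.IH by simp
qed simp

text \<open>Each of the \<open>m\<close> rows has \<open>q\<close> points from its full blocks. The
  partial blocks of ten consecutive rows hold \<open>r\<close> points in total, which gives
  \<open>q * r\<close> for the full periods of rows; an \<open>r\<close> by \<open>r\<close> corner
  remains.\<close>

lemma sum_card_residue_row:
  fixes q r :: nat and s e :: int
  assumes "r < 10" "m = 10 * q + r"
  shows "(\<Sum>d = 1..m. card (residue_row s (int m) (3 * int d + e)))
    = q * (m + r) + (\<Sum>d = 1..r. if (3 * int d + (e - s)) mod 10 < int r then 1 else 0)"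
proof -
  define h :: "nat \<Rightarrow> nat" where "h d = (if (3 * int d + (e - s)) mod 10 < int r then 1 else 0)" for d
  have per: "h (d + 10) = h d" for d
  proof -
    have "3 * int (d + 10) + (e - s) = 3 * int d + (e - s) + 10 * 3"
      by simp
    then show ?thesis by (simp only: h_def mod_mult_self2)
  qed
  have "(\<Sum>d = 1..10. h d) = (\<Sum>k = 0..9. if k < int r then 1 else 0)"
    unfolding h_def by (rule sum_residues_3)
  also have "\<dots> = card ({0..9} \<inter> {k. k < int r})"
    by (simp add: sum.If_cases)
  also have "{0..9} \<inter> {k. k < int r} = {0..<int r}"
    using assms(1) by auto
  finally have full: "(\<Sum>d = 1..10. h d) = r"
    by simp
  have "(\<Sum>d = 1..m. card (residue_row s (int m) (3 * int d + e))) = (\<Sum>d = 1..m. q + h d)"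
    unfolding assms(2) by (simp only: card_residue_row[OF assms(1)] h_def add_diff_eq)
  also have "\<dots> = q * m + (\<Sum>d = 1..10 * q + r. h d)"
    by (simp add: sum.distrib assms(2))
  also have "\<dots> = q * (m + r) + (\<Sum>d = 1..r. h d)"
    unfolding sum_periodic[of h, OF per] full by (simp add: algebra_simps)
  finally show ?thesis
    by (simp add: h_def)
qed

section \<open>The code in a square of side n - 1\<close>

lemma packing_number_ge_rows:
  fixes row :: "int \<Rightarrow> int set"
  assumes "3 \<le> n" and fin: "\<And>d. finite (row d)"
    and range: "\<And>t d. 0 < d \<Longrightarrow> d < int n \<Longrightarrow> t \<in> row d \<Longrightarrow> even (t + d) \<and> s \<le> t \<and> t < s + int n"
    and local: "\<And>t d t' d'. 0 < d \<Longrightarrow> t \<in> row d \<Longrightarrow> 0 < d' \<Longrightarrow> t' \<in> row d' \<Longrightarrow> \<bar>t - t'\<bar> \<le> 2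
      \<Longrightarrow> \<bar>d - d'\<bar> \<le> 2 \<Longrightarrow> t = t' \<and> d = d'"
    and seam: "\<And>t d t' d'. 0 < d \<Longrightarrow> d < int n \<Longrightarrow> t \<in> row d \<Longrightarrow> 0 < d' \<Longrightarrow> d' < int n \<Longrightarrow> t' \<in> row d'
      \<Longrightarrow> \<bar>t - t' - int n\<bar> \<le> 2 \<Longrightarrow> 2 < \<bar>d + d' - int n\<bar>"
  shows "(\<Sum>d = 1..n - 1. card (row (int d))) \<le> packing_number (two_token_graph (cycle_graph n))"
proof -
  define S where "S = (\<lambda>(d, t). (t, int d)) ` (SIGMA d:{1..n - 1}. row (int d))"
  have inS: "0 < d \<and> d < int n \<and> t \<in> row d" if "(t, d) \<in> S" for t d
    using that assms(1) by (auto simp: S_def)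
  have "card S = card (SIGMA d:{1..n - 1}. row (int d))"
    unfolding S_def by (rule card_image) (auto simp: inj_on_def)
  also have "\<dots> = (\<Sum>d = 1..n - 1. card (row (int d)))"
    by (simp add: fin)
  finally have "card S = (\<Sum>d = 1..n - 1. card (row (int d)))" .
  moreover have "card S \<le> packing_number (two_token_graph (cycle_graph n))"
  proof (rule packing_number_ge_card_strip[OF assms(1)])
    show "finite S"
      by (simp add: S_def fin)
    show "even (t + d) \<and> 0 < d \<and> d < int n \<and> s \<le> t \<and> t < s + int n" if "(t, d) \<in> S" for t d
      using range inS[OF that] by blast
    show "t = t' \<and> d = d'" if S: "(t, d) \<in> S" "(t', d') \<in> S" and le: "\<bar>t - t'\<bar> \<le> 2" "\<bar>d - d'\<bar> \<le> 2" for t d t' d'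
      using inS[OF S(1)] inS[OF S(2)] local[of d t d' t'] le by blast
    show "2 < \<bar>d + d' - int n\<bar>" if S: "(t, d) \<in> S" "(t', d') \<in> S" and le: "\<bar>t - t' - int n\<bar> \<le> 2" for t d t' d'
      using inS[OF S(1)] inS[OF S(2)] seam[of d t d' t'] le by blast
  qed
  ultimately show ?thesis
    by simp
qed

text \<open>The difference of \<open>t - t'\<close> and \<open>3 * (d - d')\<close> is a multiple of
  10 of absolute value at most 8, hence 0. Then 3 divides \<open>t - t'\<close>, which forces both
  differences to vanish.\<close>

lemma lattice_row_local:
  fixes t d t' d' e :: int
  assumes "t mod 10 = (3 * d + e) mod 10" "t' mod 10 = (3 * d' + e) mod 10"
    and "\<bar>t - t'\<bar> \<le> 2" "\<bar>d - d'\<bar> \<le> 2"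
  shows "t = t' \<and> d = d'"
proof -
  have "10 dvd t - (3 * d + e)" "10 dvd t' - (3 * d' + e)"
    using assms(1,2) by (simp_all only: mod_eq_dvd_iff)
  then have "10 dvd (t - (3 * d + e)) - (t' - (3 * d' + e))"
    by (rule dvd_diff)
  also have "(t - (3 * d + e)) - (t' - (3 * d' + e)) = (t - t') - 3 * (d - d')"
    by simp
  finally obtain k where "(t - t') - 3 * (d - d') = 10 * k" ..
  then show ?thesis
    using assms(3,4) by arith
qed

text \<open>With the diagonal s + n - 1 empty, only the extreme diagonals s + n - 2 and s can
  interact. Adding their congruences gives 2 y + 3 x = 0 (mod 10) for y = n - s + 1 + e and x = d +
  d' - n. Odd x is impossible, and x = -2, 0, 2 require y = 3, 0, 2 (mod 5); so y = 1, 4 are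
  safe.\<close>

lemma lattice_row_seam:
  fixes t d t' d' s e n :: int
  assumes "t mod 10 = (3 * d + e) mod 10" "t' mod 10 = (3 * d' + e) mod 10"
    and range: "t \<le> s + n - 2" "s \<le> t'" and z: "(n - s + 1 + e) mod 5 = 1 \<or> (n - s + 1 + e) mod 5 = 4"
    and le: "\<bar>t - t' - n\<bar> \<le> 2"
  shows "2 < \<bar>d + d' - n\<bar>"
proof (rule ccontr)
  define x where "x = d + d' - n"
  assume "\<not> 2 < \<bar>d + d' - n\<bar>"
  then have x: "\<bar>x\<bar> \<le> 2"
    by (simp add: x_def)
  have "t = s + n - 2" "t' = s"
    using range le by linarith+
  then have "10 dvd s + n - 2 - (3 * d + e)" "10 dvd s - (3 * d' + e)"
    using assms(1,2) by (simp_all only: mod_eq_dvd_iff)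
  then have "10 dvd (s + n - 2 - (3 * d + e)) + (s - (3 * d' + e))"
    by (rule dvd_add)
  also have "(s + n - 2 - (3 * d + e)) + (s - (3 * d' + e)) = - (2 * (n - s + 1 + e) + 3 * x)"
    by (simp add: x_def)
  finally have "10 dvd 2 * (n - s + 1 + e) + 3 * x"
    by (simp only: dvd_minus_iff)
  moreover have False if "10 dvd 2 * y + 3 * x" "y mod 5 = 1 \<or> y mod 5 = 4" for y
    using that x by presburger
  ultimately show False
    using z by blast
qed

lemma lattice_row_even:
  fixes t d e :: int
  assumes "t mod 10 = (3 * d + e) mod 10" "even e"
  shows "even (t + d)"
  using assms by presburger

lemma lattice_packing:
  assumes "3 \<le> n" "n = 10 * q + r + 1" "r < 10" "even e"
    and z: "(int n - s + 1 + e) mod 5 = 1 \<or> (int n - s + 1 + e) mod 5 = 4"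
  shows "q * (10 * q + 2 * r) + (\<Sum>d = 1..r. if (3 * int d + (e - s)) mod 10 < int r then 1 else 0)
    \<le> packing_number (two_token_graph (cycle_graph n))"
proof -
  \<comment> \<open>The length n - 1 instead of n leaves the diagonal s + n - 1 empty for the
    seam.\<close>
  define row where "row = (\<lambda>d. residue_row s (int (n - 1)) (3 * d + e))"
  have row: "s \<le> t" "t \<le> s + int n - 2" "t mod 10 = (3 * d + e) mod 10" if "t \<in> row d" for t d
    using that assms(1) by (auto simp: row_def residue_row_def)
  have "(\<Sum>d = 1..n - 1. card (row (int d))) \<le> packing_number (two_token_graph (cycle_graph n))"
  proof (rule packing_number_ge_rows[OF assms(1), where s = s])
    show "finite (row d)" for d
      by (simp add: row_def)
    show "even (t + d) \<and> s \<le> t \<and> t < s + int n" if "t \<in> row d" for t d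
      using row[OF that] lattice_row_even assms(4) by auto
    show "t = t' \<and> d = d'" if "t \<in> row d" "t' \<in> row d'" "\<bar>t - t'\<bar> \<le> 2" "\<bar>d - d'\<bar> \<le> 2" for t d t' d'
      using lattice_row_local row(3) that by blast
    show "2 < \<bar>d + d' - int n\<bar>"
      if t: "t \<in> row d" "t' \<in> row d'" "\<bar>t - t' - int n\<bar> \<le> 2" for t d t' d'
      using lattice_row_seam[OF row(3)[OF t(1)] row(3)[OF t(2)] row(2)[OF t(1)] row(1)[OF t(2)] z t(3)] .
  qed
  moreover have "(\<Sum>d = 1..n - 1. card (row (int d)))
      = q * (n - 1 + r) + (\<Sum>d = 1..r. if (3 * int d + (e - s)) mod 10 < int r then 1 else 0)"
    unfolding row_def using assms(2,3) by (intro sum_card_residue_row) auto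
  ultimately show ?thesis
    using assms(2) by (simp add: add.commute)
qed

section \<open>Repacking the boundary rows for n = 0, 2 (mod 10)\<close>

lemma residues_close:
  fixes k k' x y :: int
  assumes "\<bar>(10 * k + x) - (10 * k' + y)\<bar> \<le> 2"
  shows "(x - y) mod 10 \<in> {0, 1, 2, 8, 9}"
proof -
  define z K where "z = x - y" and "K = k - k'"
  have "\<bar>10 * K + z\<bar> \<le> 2"
    using assms by (simp add: z_def K_def algebra_simps)
  then have "z mod 10 \<in> {0, 1, 2, 8, 9}"
    by (simp; presburger)
  then show ?thesis
    by (simp only: z_def)
qed

text \<open>
  For $n = 10 q + f$ with $f \in \{0, 2\}$, the next two lemmas compare a repacked boundary row
  ($d = 1$ or $d = 2$) with another row, on the same side of the seam and across it.
\<close>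

lemma modified_rows_local:
  fixes t d t' d' f :: int
  assumes f: "f = 0 \<or> f = 2"
    and k: "t = 10 * k + x" "d = 1 \<and> x = 1 \<or> d = 1 \<and> x = 5 + f \<or> d = 2 \<and> x = 8 - 2 * f \<or> 4 \<le> d \<and> x = 3 * d + 3 * f"
    and k': "t' = 10 * k' + y" "d' = 1 \<and> y = 1 \<or> d' = 1 \<and> y = 5 + f \<or> d' = 2 \<and> y = 8 - 2 * f \<or> 4 \<le> d' \<and> y = 3 * d' + 3 * f"
    and le: "\<bar>t - t'\<bar> \<le> 2" "\<bar>d - d'\<bar> \<le> 2" and "d < 4 \<or> d' < 4"
  shows "t = t' \<and> d = d'"
proof -
  \<comment> \<open>Row 3 is empty, so row 4 is the only row of the code within two of a repacked
    row. This leaves finitely many pairs of residue classes.\<close>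
  have x: "d = 1 \<and> x = 1 \<or> d = 1 \<and> x = 5 + f \<or> d = 2 \<and> x = 8 - 2 * f \<or> d = 4 \<and> x = 12 + 3 * f"
    using assms(3,5,7,8) by auto
  have y: "d' = 1 \<and> y = 1 \<or> d' = 1 \<and> y = 5 + f \<or> d' = 2 \<and> y = 8 - 2 * f \<or> d' = 4 \<and> y = 12 + 3 * f"
    using assms(3,5,7,8) by auto
  have mod: "(x - y) mod 10 \<in> {0, 1, 2, 8, 9}"
    using le(1) unfolding k(1) k'(1) by (rule residues_close)
  from f have "d = d' \<and> x = y"
    using x y mod le(2) by safe simp_all
  moreover from this have "k = k'"
    using le(1) k(1) k'(1) by simp
  ultimately show ?thesis
    using k(1) k'(1) by simp
qed

lemma modified_rows_seam:
  fixes t d t' d' f q :: int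
  assumes f: "f = 0 \<or> f = 2" and q: "0 < q"
    and k: "t = 10 * k + x" "d = 1 \<and> x = 1 \<or> d = 1 \<and> x = 5 + f \<or> d = 2 \<and> x = 8 - 2 * f \<or> 4 \<le> d \<and> t \<le> n - 2 \<and> x = 3 * d + 3 * f"
    and k': "t' = 10 * k' + y" "d' = 1 \<and> y = 1 \<or> d' = 1 \<and> y = 5 + f \<or> d' = 2 \<and> y = 8 - 2 * f \<or> 4 \<le> d' \<and> y = 3 * d' + 3 * f"
    and n: "n = 10 * q + f" and range: "t < n" "0 \<le> t'" "d < n" "d' < n"
    and le: "\<bar>t - t' - n\<bar> \<le> 2" "\<bar>d + d' - n\<bar> \<le> 2" and "d < 4 \<or> d' < 4"
  shows False
proof -
  define w where "w = d + d' - n"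
  have w: "w = -2 \<or> w = -1 \<or> w = 0 \<or> w = 1 \<or> w = 2"
    using le(2) unfolding w_def by arith
  define c where "c = t' - t + n"
  have c: "c = 1 \<or> c = 2"
    using le(1) range(1,2) unfolding c_def by arith
  consider "d < 4" "d' < 4" | "4 \<le> d" "d' < 4" | "d < 4" "4 \<le> d'"
    using \<open>d < 4 \<or> d' < 4\<close> by linarith
  then show False
  proof cases
    case 1
    then have "d \<le> 2" "d' \<le> 2"
      using k(2) k'(2) by auto
    then show False
      using le(2) n q f by linarith
  next
    case 2
    \<comment> \<open>Rows of the code stop at n - 2, so \<open>t'\<close> must lie on the diagonal
      0, which no repacked row meets.\<close>
    then have "t' = 0"
      using k(2) range(2) le(1) by auto
    then have "y = 10 * (- k')"
      using k'(1) by simp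
    then have "y mod 10 = 0"
      by simp
    moreover have "y = 1 \<or> y = 5 + f \<or> y = 8 - 2 * f"
      using k'(2) 2(2) by auto
    ultimately show False
      using f by auto
  next
    case 3
    \<comment> \<open>Two congruences leave a finite check: \<open>mod\<close> says that
      \<open>t'\<close> is in the class of the code in row \<open>d'\<close>, and
      \<open>mod'\<close> that \<open>t'\<close> is less than \<open>c\<close>.\<close>
    define K where "K = k - k' - 4 * q"
    have d': "d' = 10 * q + f - d + w"
      using n by (simp add: w_def)
    have "y = 3 * d' + 3 * f"
      using 3 k'(2) by auto
    then have "7 * f - 3 * d + 3 * w - x - c = 10 * K"
      using k(1) k'(1) n unfolding c_def K_def d' by simp
    then have mod: "(7 * f - 3 * d + 3 * w - x - c) mod 10 = 0"
      by simp
    \<comment> \<open>This restates \<open>d' < n\<close>. It excludes the only solution of both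
      congruences: \<open>w = 2\<close> with \<open>f = 0\<close>, \<open>d = 2\<close>,
      \<open>c = 2\<close>.\<close>
    have "w < d"
      using d' range(4) n by simp
    have "x - f + c = t' + 10 * (q - k)"
      using k(1) n unfolding c_def by simp
    then have "(x - f + c) mod 10 = t' mod 10"
      by (simp only: mod_mult_self2)
    moreover have "t' < c" "t' mod 10 = t'"
      using range(1,2) c unfolding c_def by auto
    ultimately have mod': "(x - f + c) mod 10 < c"
      by simp
    have "d = 1 \<and> x = 1 \<or> d = 1 \<and> x = 5 + f \<or> d = 2 \<and> x = 8 - 2 * f"
      using k(2) 3(1) by auto
    then show False
      using f c w mod mod' \<open>w < d\<close> by safe simp_all
  qed
qed

text \<open>The code with s = 0, e = 3 f meets the seam condition and has exactly n (n - 2) / 10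
  points in the square; the final summand 1 is the gain from the repacked rows.\<close>

lemma lattice_packing_modified:
  assumes "n = 10 * q + f" "0 < q" "f = 0 \<or> f = 2"
  shows "q * (10 * q + 2 * f - 2) + 1 \<le> packing_number (two_token_graph (cycle_graph n))"
proof -
  define lat where "lat = (\<lambda>d. residue_row 0 (int (n - 1)) (3 * d + 3 * int f))"
  \<comment> \<open>Rows 1 and 2 use all \<open>n\<close> diagonals. Their classes modulo 10 are 1,
    5, 8 for \<open>f = 0\<close> and 1, 7, 4 for \<open>f = 2\<close>: cyclically at least 3 apart,
    and none is 0.\<close>
  define row where "row = (\<lambda>d. if d = 1 then residue_row 0 (int n) 1 \<union> residue_row 0 (int n) (5 + int f)
    else if d = 2 then residue_row 0 (int n) (8 - 2 * int f) else if d = 3 then {} else lat d)"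
  have n: "3 \<le> n" and m: "int (n - 1) = int n - 1"
    using assms(1,2) by auto
  have nq: "int n = 10 * int q + int f" "0 < int q" and f: "int f = 0 \<or> int f = 2"
    using assms by auto
  have row: "\<exists>k x. 0 \<le> t \<and> t < int n \<and> t = 10 * k + x \<and> (d = 1 \<and> x = 1 \<or> d = 1 \<and> x = 5 + int f
    \<or> d = 2 \<and> x = 8 - 2 * int f \<or> 4 \<le> d \<and> t \<le> int n - 2 \<and> x = 3 * d + 3 * int f)"
    if t: "t \<in> row d" "0 < d" for t d
  proof -
    consider "d = 1" "t \<in> residue_row 0 (int n) 1" | "d = 1" "t \<in> residue_row 0 (int n) (5 + int f)"
      | "d = 2" "t \<in> residue_row 0 (int n) (8 - 2 * int f)" | "4 \<le> d" "t \<in> lat d"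
      using t by (cases "d \<le> 3") (auto simp: row_def split: if_splits)
    then show ?thesis
    proof cases
      case 1
      from 1(2) obtain k where "0 \<le> t" "t < int n" "t = 10 * k + (1)"
        by (auto elim: residue_rowE)
      with 1(1) show ?thesis
        by (intro exI[of _ k] exI[of _ "1"]) simp
    next
      case 2
      from 2(2) obtain k where "0 \<le> t" "t < int n" "t = 10 * k + (5 + int f)"
        by (auto elim: residue_rowE)
      with 2(1) show ?thesis
        by (intro exI[of _ k] exI[of _ "5 + int f"]) simp
    next
      case 3
      from 3(2) obtain k where "0 \<le> t" "t < int n" "t = 10 * k + (8 - 2 * int f)"
        by (auto elim: residue_rowE)
      with 3(1) show ?thesis
        by (intro exI[of _ k] exI[of _ "8 - 2 * int f"]) simp
    next
      case 4
      from 4(2) obtain k where "0 \<le> t" "t < int n" "t = 10 * k + (3 * d + 3 * int f)" "t \<le> int n - 2"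
        unfolding lat_def m by (auto elim: residue_rowE)
      with 4(1) show ?thesis
        by (intro exI[of _ k] exI[of _ "3 * d + 3 * int f"]) simp
    qed
  qed
  have "(\<Sum>d = 1..n - 1. card (row (int d))) \<le> packing_number (two_token_graph (cycle_graph n))"
  proof (rule packing_number_ge_rows[OF n, where s = 0])
    show "finite (row d)" for d
      by (simp add: row_def lat_def)
    show "even (t + d) \<and> 0 \<le> t \<and> t < 0 + int n" if A: "0 < d" "t \<in> row d" for t d
      using row[OF A(2,1)] assms(3) by auto
    show "t = t' \<and> d = d'"
      if A: "0 < d" "t \<in> row d" "0 < d'" "t' \<in> row d'" and le: "\<bar>t - t'\<bar> \<le> 2" "\<bar>d - d'\<bar> \<le> 2" for t d t' d'
    proof -
      obtain k x where k: "t = 10 * k + x" "d = 1 \<and> x = 1 \<or> d = 1 \<and> x = 5 + int f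
        \<or> d = 2 \<and> x = 8 - 2 * int f \<or> 4 \<le> d \<and> x = 3 * d + 3 * int f"
        using row[OF A(2,1)] by blast
      obtain k' y where k': "t' = 10 * k' + y" "d' = 1 \<and> y = 1 \<or> d' = 1 \<and> y = 5 + int f
        \<or> d' = 2 \<and> y = 8 - 2 * int f \<or> 4 \<le> d' \<and> y = 3 * d' + 3 * int f"
        using row[OF A(4,3)] by blast
      show ?thesis
      proof (cases "4 \<le> d \<and> 4 \<le> d'")
        case True
        then have "t mod 10 = (3 * d + 3 * int f) mod 10" "t' mod 10 = (3 * d' + 3 * int f) mod 10"
          using k k' by auto
        then show ?thesis
          using le by (rule lattice_row_local)
      next
        case False
        then show ?thesis
          using modified_rows_local[OF f k k' le] by linarith
      qed
    qed
    show "2 < \<bar>d + d' - int n\<bar>"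
      if A: "0 < d" "d < int n" "t \<in> row d" "0 < d'" "d' < int n" "t' \<in> row d'"
        and le: "\<bar>t - t' - int n\<bar> \<le> 2" for t d t' d'
    proof -
      obtain k x where k: "t = 10 * k + x" "d = 1 \<and> x = 1 \<or> d = 1 \<and> x = 5 + int f
        \<or> d = 2 \<and> x = 8 - 2 * int f \<or> 4 \<le> d \<and> t \<le> int n - 2 \<and> x = 3 * d + 3 * int f" "t < int n"
        using row[OF A(3,1)] by blast
      obtain k' y where k': "t' = 10 * k' + y" "d' = 1 \<and> y = 1 \<or> d' = 1 \<and> y = 5 + int f
        \<or> d' = 2 \<and> y = 8 - 2 * int f \<or> 4 \<le> d' \<and> y = 3 * d' + 3 * int f" "0 \<le> t'"
        using row[OF A(6,4)] by blast
      show ?thesis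
      proof (cases "4 \<le> d \<and> 4 \<le> d'")
        case True
        then have "t mod 10 = (3 * d + 3 * int f) mod 10" "t' mod 10 = (3 * d' + 3 * int f) mod 10"
          using k k' by auto
        moreover have "t \<le> 0 + int n - 2"
          using True k(2) by auto
        moreover have "(int n - 0 + 1 + 3 * int f) mod 5 = 1 \<or> (int n - 0 + 1 + 3 * int f) mod 5 = 4"
          using f nq(1) by presburger
        ultimately show ?thesis
          using k'(3) le by (intro lattice_row_seam)
      next
        case False
        then show ?thesis
          using modified_rows_seam[OF f nq(2) k(1,2) k'(1,2) nq(1) k(3) k'(3) A(2,5) le] by force
      qed
    qed
  qed
  moreover have "(\<Sum>d = 1..n - 1. card (row (int d))) = (\<Sum>d = 1..n - 1. card (lat (int d))) + 1"
  proof -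
    have split: "(\<Sum>d = 1..n - 1. h d) = h 1 + h 2 + h 3 + (\<Sum>d = 4..n - 1. h d)" for h :: "nat \<Rightarrow> nat"
    proof -
      have "{1..n - 1} = {1, 2, 3} \<union> {4..n - 1}"
        using assms(1-3) by auto
      then show ?thesis
        by (simp add: sum.union_disjoint)
    qed
    have "(\<Sum>d = 4..n - 1. card (row (int d))) = (\<Sum>d = 4..n - 1. card (lat (int d)))"
      by (rule sum.cong) (auto simp: row_def)
    moreover have "residue_row 0 (int n) 1 \<inter> residue_row 0 (int n) (5 + int f) = {}"
      using assms(3) by (auto simp: residue_row_def)
    then have "card (row 1) = card (residue_row 0 (int n) 1) + card (residue_row 0 (int n) (5 + int f))"
      by (simp add: row_def card_Un_disjoint)
    moreover have "card (row 2) = card (residue_row 0 (int n) (8 - 2 * int f))" "card (row 3) = 0"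
      by (simp_all add: row_def)
    moreover have "card (residue_row 0 (int n) x) = q + (if x mod 10 < int f then 1 else 0)" for x
      using card_residue_row[of f 0 q x] assms(1,3) by auto
    \<comment> \<open>Rows 1 to 3 of the code hold 3 q - 1 points for \<open>f = 0\<close> and 3 q
      for \<open>f = 2\<close>, one fewer than the repacked rows.\<close>
    moreover have "card (lat 1) + card (lat 2) + card (lat 3) + 1 = 3 * q + f div 2"
      using assms(3)
    proof
      assume f: "f = 0"
      have "int (n - 1) = int (10 * (q - 1) + 9)"
        using assms(1,2) f by simp
      then show ?thesis
        unfolding lat_def using card_residue_row[of 9 0 "q - 1"] assms(2) f by simp
    next
      assume f: "f = 2"
      have "int (n - 1) = int (10 * q + 1)"
        using assms(1) f by simp
      then show ?thesis
        unfolding lat_def using card_residue_row[of 1 0 q] f by simp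
    qed
    ultimately show ?thesis
      unfolding split using assms(3) by (elim disjE) simp_all
  qed
  moreover have "(\<Sum>d = 1..n - 1. card (lat (int d))) = q * (10 * q + 2 * f - 2)"
    using assms(3)
  proof
    assume f: "f = 0"
    obtain p where p: "q = Suc p"
      using assms(2) by (cases q) auto
    have "(\<Sum>d = 1..n - 1. card (lat (int d))) = p * (n - 1 + 9)
        + (\<Sum>d = 1..9. if (3 * int d + (3 * int f - 0)) mod 10 < int 9 then 1 else 0)"
      unfolding lat_def using p assms(1) f by (intro sum_card_residue_row) auto
    then show ?thesis
      using assms(1) p f by (simp add: eval_nat_numeral algebra_simps)
  next
    assume f: "f = 2"
    have "(\<Sum>d = 1..n - 1. card (lat (int d))) = q * (n - 1 + 1)
        + (\<Sum>d = 1..1. if (3 * int d + (3 * int f - 0)) mod 10 < int 1 then 1 else 0)"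
      unfolding lat_def using assms(1) f by (intro sum_card_residue_row) auto
    then show ?thesis
      using assms(1) f by simp
  qed
  ultimately show ?thesis by simp
qed

section \<open>Choice of the parameters for each residue of n modulo 10\<close>

theorem theorem2:
  fixes n :: nat
  assumes "3 \<le> n"
  shows "int (packing_number (two_token_graph (cycle_graph n)))
           \<ge> \<lfloor>real n * (real n - 2) / 10\<rfloor> + 1"
proof -
  let ?\<rho> = "packing_number (two_token_graph (cycle_graph n))"
  \<comment> \<open>As (n - 1)^2 = n (n - 2) + 1, the bound on \<open>K\<close> makes it strictly
    larger than n (n - 2) / 10, hence larger than the floor.\<close>
  have goal: ?thesis if K: "K \<le> ?\<rho>" "(n - 1)\<^sup>2 \<le> 10 * K" for K
  proof -
    have "real ((n - 1)\<^sup>2) \<le> real (10 * K)"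
      using K(2) by (simp only: of_nat_le_iff)
    moreover have "real ((n - 1)\<^sup>2) = real n * (real n - 2) + 1"
      using assms by (simp only: of_nat_power of_nat_diff) (simp add: power2_eq_square algebra_simps)
    ultimately have "real n * (real n - 2) / 10 < real_of_int (int K)"
      by simp
    then have "\<lfloor>real n * (real n - 2) / 10\<rfloor> < int K"
      by (simp only: floor_less_iff)
    then show ?thesis
      using K(1) by linarith
  qed
  \<comment> \<open>Both requirements lose \<open>q\<close>: n = r + 1 (mod 5), and the terms of (n
    - 1)^2 involving \<open>q\<close> are matched exactly by the full blocks. What remains is a
    finite check on the \<open>r\<close> by \<open>r\<close> corner.\<close>
  have lattice: ?thesis
    if n: "n = 10 * q + r + 1" "r < 10" "even e"
      and z: "(int r + 2 + e - s) mod 5 = 1 \<or> (int r + 2 + e - s) mod 5 = 4"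
      and sq: "r\<^sup>2 \<le> 10 * (\<Sum>d = 1..r. if (3 * int d + (e - s)) mod 10 < int r then 1 else 0)" for q r s e
  proof (rule goal[OF lattice_packing[OF assms n]])
    have "int n - s + 1 + e = int r + 2 + e - s + 5 * (2 * int q)"
      using n(1) by simp
    then have "(int n - s + 1 + e) mod 5 = (int r + 2 + e - s) mod 5"
      by (simp only: mod_mult_self2)
    then show "(int n - s + 1 + e) mod 5 = 1 \<or> (int n - s + 1 + e) mod 5 = 4"
      using z by simp
    have eq: "(n - 1)\<^sup>2 = 10 * (q * (10 * q + 2 * r)) + r\<^sup>2"
      by (simp add: n power2_eq_square algebra_simps)
    show "(n - 1)\<^sup>2 \<le> 10 * (q * (10 * q + 2 * r)
        + (\<Sum>d = 1..r. if (3 * int d + (e - s)) mod 10 < int r then 1 else 0))"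
      unfolding eq distrib_left using sq by (rule add_left_mono)
  qed
  have modified: ?thesis if n: "n = 10 * q + f" "f = 0 \<or> f = 2" for q f
  proof -
    obtain p where p: "q = Suc p"
      using assms n by (cases q) auto
    then have "q * (10 * q + 2 * f - 2) + 1 \<le> ?\<rho>"
      using n by (intro lattice_packing_modified) auto
    then show ?thesis
      by (rule goal) (use n p in \<open>auto simp: power2_eq_square algebra_simps\<close>)
  qed
  define q where "q = n div 10"
  have "n mod 10 = 0 \<or> n mod 10 = 1 \<or> n mod 10 = 2 \<or> n mod 10 = 3 \<or> n mod 10 = 4
    \<or> n mod 10 = 5 \<or> n mod 10 = 6 \<or> n mod 10 = 7 \<or> n mod 10 = 8 \<or> n mod 10 = 9"
    by presburger
  moreover have n: "n = 10 * q + n mod 10"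
    by (simp add: q_def)
  \<comment> \<open>The seam condition and the corner count depend on e - s only; since e is even, s
    = 1 serves to make this difference odd. For r = 1 and r = 9 no value of e - s satisfies both,
    which is why n = 2, 0 (mod 10) go to \<open>modified\<close>.\<close>
  ultimately consider "n = 10 * q + 0" | "n = 10 * q + 0 + 1" | "n = 10 * q + 2" | "n = 10 * q + 2 + 1"
    | "n = 10 * q + 3 + 1" | "n = 10 * q + 4 + 1" | "n = 10 * q + 5 + 1" | "n = 10 * q + 6 + 1"
    | "n = 10 * q + 7 + 1" | "n = 10 * q + 8 + 1"
    by force
  then show ?thesis
  proof cases
    case 1
    then show ?thesis
      by (rule modified) simp
  next
    case 2
    then show ?thesis
      by (rule lattice[where s = 0 and e = 4]) (use 2 in \<open>simp_all add: eval_nat_numeral\<close>)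
  next
    case 3
    then show ?thesis
      by (rule modified) simp
  next
    case 4
    then show ?thesis
      by (rule lattice[where s = 1 and e = 8]) (use 4 in \<open>simp_all add: eval_nat_numeral\<close>)
  next
    case 5
    then show ?thesis
      by (rule lattice[where s = 0 and e = 4]) (use 5 in \<open>simp_all add: eval_nat_numeral\<close>)
  next
    case 6
    then show ?thesis
      by (rule lattice[where s = 0 and e = 0]) (use 6 in \<open>simp_all add: eval_nat_numeral\<close>)
  next
    case 7
    then show ?thesis
      by (rule lattice[where s = 1 and e = 0]) (use 7 in \<open>simp_all add: eval_nat_numeral\<close>)
  next
    case 8
    then show ?thesis
      by (rule lattice[where s = 0 and e = 8]) (use 8 in \<open>simp_all add: eval_nat_numeral\<close>)
  next
    case 9
    then show ?thesis
      by (rule lattice[where s = 0 and e = 0]) (use 9 in \<open>simp_all add: eval_nat_numeral\<close>)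
  next
    case 10
    then show ?thesis
      by (rule lattice[where s = 1 and e = 0]) (use 10 in \<open>simp_all add: eval_nat_numeral\<close>)
  qed
qed

end
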